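(* Let $\Sigma$ be a $k$-dimensional isotropic submanifold of $\mathbb{C}^n$ that is an initial data with respect to $(B,b)$, where $B\in GL(n,\mathbb{C})$ and $b\in\mathbb{C}^n$. Let $I\subset\mathbb{R}$ be an interval containing $0$ and let $\alpha: I\to\mathbb{C}$ be any smooth curve. Suppose $(A(s),a(s))$, with $A(s)\in GL(n,\mathbb{C})$ and $a(s)\in\mathbb{C}^n$ for $s\in I$, is a smooth curve satisfying $$A^*(s)\dot A(s)=\alpha(s)B,\qquad A^*(s)\dot a(s)=\alpha(s)b,\qquad A(0)=\mathrm{Id},\qquad a(0)=0,$$ where $A^*$ is the conjugate transpose of $A$ and the dot denotes $d/ds$. Then $A(s)\Sigma+a(s)$, that is, the submanifold of $\mathbb{C}^n$ parametrized by $$F: I\times\Sigma\to\mathbb{C}^n,\qquad F(s,p)=A(s)X_p+a(s),$$ is isotropic.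
   Context: $\mathbb{C}^n$ carries its standard Hermitian product $\langle\cdot,\cdot\rangle$ and standard Kähler form $\omega$ (up to sign, $\omega$ is the imaginary part of $\langle\cdot,\cdot\rangle$). For a submanifold $\Sigma$ and $p\in\Sigma$, $X_p\in\mathbb{C}^n$ denotes the position vector of $p$. A submanifold is isotropic if $\omega$ restricts to zero on it; a submanifold parametrized by a map $F$ (not necessarily embedded) is isotropic if $F^*\omega=0$. A $k$-dimensional isotropic submanifold $\Sigma$ of $\mathbb{C}^n$ is called an initial data with respect to $(B,b)$, with $B\in GL(n,\mathbb{C})$ and $b\in\mathbb{C}^n$, if at every point $p\in\Sigma$ one has $\langle V, BX_p+b\rangle=0$ for all $V\in T_p\Sigma$ (vanishing of the full complex-valued Hermitian product). *)

theory Defs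
  imports "HOL-Analysis.Analysis"
begin

definition hermitian :: "complex^'n \<Rightarrow> complex^'n \<Rightarrow> complex" where
  "hermitian x y = (\<Sum>i\<in>UNIV. x $ i * cnj (y $ i))"

text \<open>In coordinates \<open>z\<^sub>j = x\<^sub>j + i y\<^sub>j\<close> this is \<open>\<Sum>\<^sub>j dx\<^sub>j \<and> dy\<^sub>j\<close>.\<close>

definition kaehler_form :: "complex^'n \<Rightarrow> complex^'n \<Rightarrow> real" where
  "kaehler_form x y = - Im (hermitian x y)"

definition conj_transpose :: "complex^'n^'m \<Rightarrow> complex^'m^'n" where
  "conj_transpose A = (\<chi> i j. cnj (A $ j $ i))"

text \<open>The definition is used for open subsets of linear subspaces and for
  intervals of reals (one-sided derivatives at end points).\<close>

primrec Ck_on :: "nat \<Rightarrow> 'a::real_normed_vector set \<Rightarrow> ('a \<Rightarrow> 'b::real_normed_vector) \<Rightarrow> bool" where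
  "Ck_on 0 S f \<longleftrightarrow> continuous_on S f"
| "Ck_on (Suc k) S f \<longleftrightarrow>
     (\<exists>f'. (\<forall>x\<in>S. (f has_derivative f' x) (at x within S)) \<and> (\<forall>v. Ck_on k S (\<lambda>x. f' x v)))"

definition smooth_on :: "'a::real_normed_vector set \<Rightarrow> ('a \<Rightarrow> 'b::real_normed_vector) \<Rightarrow> bool" where
  "smooth_on S f \<longleftrightarrow> (\<forall>k. Ck_on k S f)"

text \<open>A submanifold \<open>\<Sigma>\<close> of a Euclidean space is given by a topological space \<open>M\<close> together with
  its position map \<open>X\<close>, which is an immersion; the embedded submanifold with underlying set \<open>S\<close>
  is the case \<open>M = top_of_set S\<close>, \<open>X = id\<close>. The smooth structure is
  encoded through local parametrizations \<open>\<phi>\<close> defined on open subsets \<open>D\<close> of a \<open>k\<close>-dimensional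
  linear subspace \<open>L\<close> of the ambient space, which plays the role of \<open>\<real>\<^sup>k\<close> (so that \<open>k\<close> is a natural
  number, \<open>k = 0\<close> included). No compatibility condition is needed: as \<open>X \<circ> \<phi>\<close> is an immersion
  for every \<open>\<phi>\<close>, the transition homeomorphisms are automatically smooth.\<close>

definition local_param ::
    "'a topology \<Rightarrow> ('a \<Rightarrow> 'b::euclidean_space) \<Rightarrow> 'b set \<Rightarrow> 'b set \<Rightarrow> ('b \<Rightarrow> 'a) \<Rightarrow> bool" where
  "local_param M X L D \<phi> \<longleftrightarrow>
     subspace L \<and> openin (top_of_set L) D \<and> openin M (\<phi> ` D) \<and>
     homeomorphic_map (top_of_set D) (subtopology M (\<phi> ` D)) \<phi> \<and>
     smooth_on D (X \<circ> \<phi>) \<and>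
     (\<forall>u\<in>D. \<exists>G. ((X \<circ> \<phi>) has_derivative G) (at u within D) \<and> inj_on G L)"

definition submanifold :: "nat \<Rightarrow> 'a topology \<Rightarrow> ('a \<Rightarrow> 'b::euclidean_space) \<Rightarrow> bool" where
  "submanifold k M X \<longleftrightarrow>
     Hausdorff_space M \<and> second_countable M \<and>
     (\<forall>p\<in>topspace M. \<exists>L D \<phi>. dim L = k \<and> local_param M X L D \<phi> \<and> p \<in> \<phi> ` D)"

definition tangent_space :: "'a topology \<Rightarrow> ('a \<Rightarrow> 'b::euclidean_space) \<Rightarrow> 'a \<Rightarrow> 'b set" where
  "tangent_space M X p =
     {G v | L D \<phi> u G v. local_param M X L D \<phi> \<and> u \<in> D \<and> \<phi> u = p \<and>
        ((X \<circ> \<phi>) has_derivative G) (at u within D) \<and> v \<in> L}"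

definition isotropic_submanifold :: "nat \<Rightarrow> 'a topology \<Rightarrow> ('a \<Rightarrow> complex^'n) \<Rightarrow> bool" where
  "isotropic_submanifold k M X \<longleftrightarrow>
     submanifold k M X \<and>
     (\<forall>p\<in>topspace M. \<forall>V\<in>tangent_space M X p. \<forall>W\<in>tangent_space M X p. kaehler_form V W = 0)"

definition initial_data ::
    "nat \<Rightarrow> 'a topology \<Rightarrow> ('a \<Rightarrow> complex^'n) \<Rightarrow> complex^'n^'n \<Rightarrow> complex^'n \<Rightarrow> bool" where
  "initial_data k M X B b \<longleftrightarrow>
     isotropic_submanifold k M X \<and>
     (\<forall>p\<in>topspace M. \<forall>V\<in>tangent_space M X p. hermitian V (B *v X p + b) = 0)"

text \<open>\<open>F\<^sup>*\<omega> = 0\<close> for a map \<open>F\<close> on the product \<open>I \<times> \<Sigma>\<close>, where \<open>\<Sigma>\<close> is the submanifold \<open>(M, X)\<close>, expressed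
  in the local parametrizations \<open>(s, u) \<mapsto> (s, \<phi> u)\<close> of \<open>I \<times> \<Sigma>\<close>, whose tangent directions are the
  elements of \<open>\<real> \<times> L\<close>.\<close>

definition isotropic_map ::
    "real set \<Rightarrow> 'a topology \<Rightarrow> ('a \<Rightarrow> complex^'n) \<Rightarrow> (real \<times> 'a \<Rightarrow> complex^'n) \<Rightarrow> bool" where
  "isotropic_map I M X F \<longleftrightarrow>
     (\<forall>L D \<phi>. local_param M X L D \<phi> \<longrightarrow>
        (\<forall>s\<in>I. \<forall>u\<in>D. \<exists>G.
           ((\<lambda>(t, w). F (t, \<phi> w)) has_derivative G) (at (s, u) within I \<times> D) \<and>
           (\<forall>\<xi>\<in>UNIV \<times> L. \<forall>\<eta>\<in>UNIV \<times> L. kaehler_form (G \<xi>) (G \<eta>) = 0)))"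

end

theory Submission
  imports Defs
begin

text \<open>The tangent vectors of \<open>F\<close> are \<open>A V\<close> with \<open>V\<close> tangent to \<open>\<Sigma>\<close>, and \<open>A' X + a'\<close>. As
  \<open>A\<^sup>*(A' X + a') = \<alpha>(B X + b)\<close>, the mixed products \<open>\<langle>A V, A' X + a'\<rangle>\<close> vanish by the initial data
  condition. Differentiating that condition along \<open>\<Sigma>\<close> and using the symmetry of second derivatives
  shows that \<open>\<langle>V, B W\<rangle>\<close> is symmetric in the tangent vectors \<open>V\<close>, \<open>W\<close>. Hence
  \<open>d/ds \<langle>A V, A W\<rangle> = cnj \<langle>W, \<alpha> B V\<rangle> + \<langle>V, \<alpha> B W\<rangle>\<close> is real, so \<open>\<omega>(A V, A W)\<close> keeps its value
  \<open>\<omega>(V, W) = 0\<close> at \<open>s = 0\<close>.\<close>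

section \<open>Symmetry of second derivatives on relatively open subsets of a subspace\<close>

text \<open>The chain rule, with the scalar pulled out by linearity; in this shape the one-variable
  mean value theorem yields the increment as a multiple of \<open>h\<close>.\<close>

lemma has_derivative_along_segment:
  assumes f: "\<And>x. x \<in> D \<Longrightarrow> (f has_derivative f' x) (at x within D)"
    and D: "\<And>s. s \<in> S \<Longrightarrow> u + s *\<^sub>R v \<in> D" and s: "s \<in> S"
  shows "((\<lambda>s. f (u + s *\<^sub>R v)) has_derivative (\<lambda>r. r *\<^sub>R f' (u + s *\<^sub>R v) v)) (at s within S)"
proof -
  have "((\<lambda>s. u + s *\<^sub>R v) has_derivative (\<lambda>r. r *\<^sub>R v)) (at s within S)"
    by (auto intro!: derivative_eq_intros)
  moreover have "(f has_derivative f' (u + s *\<^sub>R v)) (at (u + s *\<^sub>R v) within (\<lambda>s. u + s *\<^sub>R v) ` S)"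
    by (rule has_derivative_subset[OF f]) (use D s in auto)
  ultimately have "((\<lambda>s. f (u + s *\<^sub>R v)) has_derivative (\<lambda>r. f' (u + s *\<^sub>R v) (r *\<^sub>R v))) (at s within S)"
    by (rule has_derivative_in_compose)
  moreover have "linear (f' (u + s *\<^sub>R v))"
    using f[OF D[OF s]] by (rule has_derivative_linear)
  ultimately show ?thesis
    by (simp add: linear_scale)
qed

text \<open>Two applications of the mean value theorem: first in direction \<open>v\<close> to the
  difference of \<open>f\<close> between the two sides displaced by \<open>h *\<^sub>R w\<close>,
  then in direction \<open>w\<close> to the first derivative along \<open>v\<close>.\<close>

lemma second_difference_mean_value:
  fixes f :: "'a::real_normed_vector \<Rightarrow> real"
  assumes h: "0 < h"
    and D: "\<And>s t. s \<in> {0..h} \<Longrightarrow> t \<in> {0..h} \<Longrightarrow> u + s *\<^sub>R v + t *\<^sub>R w \<in> D"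
    and f: "\<And>x. x \<in> D \<Longrightarrow> (f has_derivative f' x) (at x within D)"
    and f'': "\<And>x. x \<in> D \<Longrightarrow> ((\<lambda>x. f' x v) has_derivative f'' x) (at x within D)"
  shows "\<exists>s\<in>{0..h}. \<exists>t\<in>{0..h}.
    f (u + h *\<^sub>R v + h *\<^sub>R w) - f (u + h *\<^sub>R v) - f (u + h *\<^sub>R w) + f u
      = h * h * f'' (u + s *\<^sub>R v + t *\<^sub>R w) w"
proof -
  have D': "(u + t *\<^sub>R w) + s *\<^sub>R v \<in> D" if "s \<in> {0..h}" "t \<in> {0..h}" for s t
    using D[OF that] by (simp add: algebra_simps)
  have deriv: "((\<lambda>s. f ((u + t *\<^sub>R w) + s *\<^sub>R v)) has_derivative
      (\<lambda>r. r *\<^sub>R f' ((u + t *\<^sub>R w) + s *\<^sub>R v) v)) (at s within {0..h})"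
    if "s \<in> {0..h}" "t \<in> {0..h}" for s t
    by (rule has_derivative_along_segment[OF f]) (use D' that in auto)
  \<comment> \<open>The term \<open>0 *\<^sub>R w\<close> is kept so that both summands are
    instances of \<open>deriv\<close>, at \<open>t = h\<close> and \<open>t = 0\<close>.\<close>
  have "((\<lambda>s. f ((u + h *\<^sub>R w) + s *\<^sub>R v) - f ((u + 0 *\<^sub>R w) + s *\<^sub>R v)) has_derivative
      (\<lambda>r. r *\<^sub>R f' ((u + h *\<^sub>R w) + s *\<^sub>R v) v - r *\<^sub>R f' ((u + 0 *\<^sub>R w) + s *\<^sub>R v) v)) (at s within {0..h})"
    if "0 \<le> s" "s \<le> h" for s
    using that h by (intro has_derivative_diff deriv) auto
  from mvt_simple[OF h this] obtain s where s: "s \<in> {0<..<h}"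
    and fs: "f ((u + h *\<^sub>R w) + h *\<^sub>R v) - f (u + h *\<^sub>R v) - (f (u + h *\<^sub>R w) - f u)
      = h * (f' ((u + h *\<^sub>R w) + s *\<^sub>R v) v - f' (u + s *\<^sub>R v) v)"
    by (auto simp: algebra_simps)
  have "((\<lambda>t. f' ((u + s *\<^sub>R v) + t *\<^sub>R w) v) has_derivative
      (\<lambda>r. r *\<^sub>R f'' ((u + s *\<^sub>R v) + t *\<^sub>R w) w)) (at t within {0..h})"
    if "0 \<le> t" "t \<le> h" for t
    by (rule has_derivative_along_segment[where f = "\<lambda>x. f' x v", OF f'']) (use D s that in auto)
  from mvt_simple[OF h this] obtain t where t: "t \<in> {0<..<h}"
    and ft: "f' ((u + s *\<^sub>R v) + h *\<^sub>R w) v - f' (u + s *\<^sub>R v) v = h * f'' ((u + s *\<^sub>R v) + t *\<^sub>R w) w"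
    by auto
  have "f (u + h *\<^sub>R v + h *\<^sub>R w) - f (u + h *\<^sub>R v) - f (u + h *\<^sub>R w) + f u
      = h * h * f'' (u + s *\<^sub>R v + t *\<^sub>R w) w"
    using fs ft by (simp add: algebra_simps)
  with s t show ?thesis
    by (meson greaterThanLessThan_subseteq_atLeastAtMost_iff order_refl subsetD)
qed

text \<open>The second difference over a parallelogram does not depend on the order of
  \<open>v\<close> and \<open>w\<close>, so a value of \<open>fv\<close> in direction
  \<open>w\<close> and one of \<open>fw\<close> in direction \<open>v\<close>, at two nearby points,
  agree; continuity carries this to \<open>u\<close>. Directions in \<open>L\<close> keep the
  parallelogram inside \<open>D\<close>, which may have empty interior in the ambient space.\<close>

lemma second_derivative_symmetric_real:
  fixes f :: "'a::real_normed_vector \<Rightarrow> real"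
  assumes L: "subspace L" and D: "openin (top_of_set L) D"
    and u: "u \<in> D" and v: "v \<in> L" and w: "w \<in> L"
    and f: "\<And>x. x \<in> D \<Longrightarrow> (f has_derivative f' x) (at x within D)"
    and fv: "\<And>x. x \<in> D \<Longrightarrow> ((\<lambda>x. f' x v) has_derivative fv x) (at x within D)"
    and fw: "\<And>x. x \<in> D \<Longrightarrow> ((\<lambda>x. f' x w) has_derivative fw x) (at x within D)"
    and cv: "continuous_on D (\<lambda>x. fv x w)" and cw: "continuous_on D (\<lambda>x. fw x v)"
  shows "fv u w = fw u v"
proof -
  \<comment> \<open>The summand 0 gives the shape required by
    \<open>field_le_epsilon\<close>.\<close>
  have "\<bar>fv u w - fw u v\<bar> \<le> 0 + e" if e: "e > 0" for e
  proof -
    obtain d1 where d1: "d1 > 0" "\<And>x. x \<in> D \<Longrightarrow> dist x u < d1 \<Longrightarrow> dist (fv x w) (fv u w) < e/2"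
      using cv u e unfolding continuous_on_iff by (meson half_gt_zero)
    obtain d2 where d2: "d2 > 0" "\<And>x. x \<in> D \<Longrightarrow> dist x u < d2 \<Longrightarrow> dist (fw x v) (fw u v) < e/2"
      using cw u e unfolding continuous_on_iff by (meson half_gt_zero)
    obtain d3 where d3: "d3 > 0" "ball u d3 \<inter> L \<subseteq> D"
      using D u by (auto simp: openin_contains_ball)
    define d where "d = min d1 (min d2 d3)"
    have d: "d > 0" using d1 d2 d3 by (simp add: d_def)
    \<comment> \<open>The parallelogram with sides \<open>h *\<^sub>R v\<close> and
      \<open>h *\<^sub>R w\<close> has all its points at distance less than \<open>d\<close> from
      \<open>u\<close>; the 1 keeps the denominator positive and the bound strict.\<close>
    define h where "h = d / (norm v + norm w + 1)"
    have "norm v + norm w + 1 > 0"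
      by (simp add: add_nonneg_pos)
    then have h: "h > 0" and hd: "h * (norm v + norm w + 1) = d"
      using d by (auto simp: h_def)
    have near: "dist (u + s *\<^sub>R v + t *\<^sub>R w) u < d" if "s \<in> {0..h}" "t \<in> {0..h}" for s t
    proof -
      have "dist (u + s *\<^sub>R v + t *\<^sub>R w) u = norm (s *\<^sub>R v + t *\<^sub>R w)"
        by (simp add: dist_norm add.assoc)
      also have "\<dots> \<le> s * norm v + t * norm w"
        using norm_triangle_ineq[of "s *\<^sub>R v" "t *\<^sub>R w"] that by simp
      also have "\<dots> \<le> h * norm v + h * norm w"
        using that by (intro add_mono mult_right_mono) auto
      also have "\<dots> < d"
        using h hd by (simp add: algebra_simps)
      finally show ?thesis .
    qed
    have "u \<in> L" using D u openin_imp_subset by blast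
    then have inL: "u + s *\<^sub>R v + t *\<^sub>R w \<in> L" for s t
      using L v w by (simp add: subspace_add subspace_scale)
    have inD: "u + s *\<^sub>R v + t *\<^sub>R w \<in> D" if "s \<in> {0..h}" "t \<in> {0..h}" for s t
      using near[OF that] inL d3 by (force simp: d_def dist_commute)
    have inD': "u + t *\<^sub>R w + s *\<^sub>R v \<in> D" if "t \<in> {0..h}" "s \<in> {0..h}" for s t
      using inD[OF that(2,1)] by (simp add: algebra_simps)
    obtain s t where st: "s \<in> {0..h}" "t \<in> {0..h}" and
      1: "f (u + h *\<^sub>R v + h *\<^sub>R w) - f (u + h *\<^sub>R v) - f (u + h *\<^sub>R w) + f u
      = h * h * fv (u + s *\<^sub>R v + t *\<^sub>R w) w"
      using second_difference_mean_value[OF h inD f fv] by blast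
    \<comment> \<open>The same second difference, evaluated with the roles of \<open>v\<close> and
      \<open>w\<close> exchanged.\<close>
    obtain t' s' where st': "t' \<in> {0..h}" "s' \<in> {0..h}" and
      2: "f (u + h *\<^sub>R w + h *\<^sub>R v) - f (u + h *\<^sub>R w) - f (u + h *\<^sub>R v) + f u
      = h * h * fw (u + t' *\<^sub>R w + s' *\<^sub>R v) v"
      using second_difference_mean_value[OF h inD' f fw] by blast
    have "h * h * fv (u + s *\<^sub>R v + t *\<^sub>R w) w = h * h * fw (u + s' *\<^sub>R v + t' *\<^sub>R w) v"
      using 1 2 by (simp add: algebra_simps)
    then have "fv (u + s *\<^sub>R v + t *\<^sub>R w) w = fw (u + s' *\<^sub>R v + t' *\<^sub>R w) v"
      using h by simp
    moreover have "dist (fv (u + s *\<^sub>R v + t *\<^sub>R w) w) (fv u w) < e/2"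
      using d1(2)[OF inD[OF st]] near[OF st] by (simp add: d_def)
    moreover have "dist (fw (u + s' *\<^sub>R v + t' *\<^sub>R w) v) (fw u v) < e/2"
      using d2(2)[OF inD[OF st'(2,1)]] near[OF st'(2,1)] by (simp add: d_def)
    ultimately show ?thesis
      by (simp add: dist_real_def abs_if split: if_splits)
  qed
  then have "\<bar>fv u w - fw u v\<bar> \<le> 0"
    by (rule field_le_epsilon)
  then show ?thesis by simp
qed

text \<open>Reduction to the real case by taking the inner product with an arbitrary vector
  \<open>c\<close>.\<close>

lemma second_derivative_symmetric:
  fixes f :: "'a::real_normed_vector \<Rightarrow> 'b::real_inner"
  assumes L: "subspace L" and D: "openin (top_of_set L) D"
    and u: "u \<in> D" and v: "v \<in> L" and w: "w \<in> L"
    and f: "\<And>x. x \<in> D \<Longrightarrow> (f has_derivative f' x) (at x within D)"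
    and fv: "\<And>x. x \<in> D \<Longrightarrow> ((\<lambda>x. f' x v) has_derivative fv x) (at x within D)"
    and fw: "\<And>x. x \<in> D \<Longrightarrow> ((\<lambda>x. f' x w) has_derivative fw x) (at x within D)"
    and cv: "continuous_on D (\<lambda>x. fv x w)" and cw: "continuous_on D (\<lambda>x. fw x v)"
  shows "fv u w = fw u v"
proof -
  have "fv u w \<bullet> c = fw u v \<bullet> c" for c
    by (rule second_derivative_symmetric_real[OF L D u v w,
          where f = "\<lambda>x. f x \<bullet> c" and f' = "\<lambda>x y. f' x y \<bullet> c"
            and fv = "\<lambda>x y. fv x y \<bullet> c" and fw = "\<lambda>x y. fw x y \<bullet> c"])
       (auto intro!: has_derivative_inner_left f fv fw continuous_intros cv cw)
  then show ?thesis
    using vector_eq_rdot[of "fv u w" "fw u v"] by simp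
qed

section \<open>The Hermitian product\<close>

text \<open>The product is antilinear in its second argument but bilinear over the reals, which is
  what the product rule requires; boundedness is automatic in finite dimension.\<close>

lemma bounded_bilinear_hermitian:
  "bounded_bilinear (hermitian :: complex^'n \<Rightarrow> complex^'n \<Rightarrow> complex)"
  by (auto simp: bilinear_conv_bounded_bilinear[symmetric] bilinear_def hermitian_def algebra_simps
      sum.distrib scaleR_sum_right intro!: linearI)

lemma bounded_bilinear_matrix_vector_mult:
  "bounded_bilinear ((*v) :: complex^'n^'m \<Rightarrow> complex^'n \<Rightarrow> complex^'m)"
  by (auto simp: bilinear_conv_bounded_bilinear[symmetric] bilinear_def matrix_vector_mult_def
      vec_eq_iff algebra_simps sum.distrib scaleR_sum_right intro!: linearI)

lemmas has_derivative_hermitian = bounded_bilinear.FDERIV[OF bounded_bilinear_hermitian]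
lemmas has_derivative_matrix_vector_mult =
  bounded_bilinear.FDERIV[OF bounded_bilinear_matrix_vector_mult]

lemma hermitian_add_left: "hermitian (x + y) z = hermitian x z + hermitian y z"
  and hermitian_add_right: "hermitian x (y + z) = hermitian x y + hermitian x z"
  and hermitian_scaleR_left: "hermitian (r *\<^sub>R x) z = r *\<^sub>R hermitian x z"
  and hermitian_scaleR_right: "hermitian x (r *\<^sub>R z) = r *\<^sub>R hermitian x z"
  by (simp_all add: hermitian_def algebra_simps sum.distrib scaleR_sum_right)

lemma hermitian_commute: "hermitian x y = cnj (hermitian y x)"
  by (simp add: hermitian_def mult.commute)

lemma hermitian_scale_right: "hermitian x (c *s y) = cnj c * hermitian x y"
  by (simp add: hermitian_def sum_distrib_left algebra_simps)

text \<open>The conjugate transpose is the adjoint; through this identity the two differential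
  equations enter the computation of products.\<close>

lemma hermitian_matrix_vector_mult_left:
  "hermitian (A *v x) y = hermitian x (conj_transpose A *v y)"
proof -
  have "hermitian (A *v x) y = (\<Sum>i\<in>UNIV. \<Sum>j\<in>UNIV. A $ i $ j * x $ j * cnj (y $ i))"
    by (simp add: hermitian_def matrix_vector_mult_def sum_distrib_right)
  also have "\<dots> = (\<Sum>j\<in>UNIV. \<Sum>i\<in>UNIV. A $ i $ j * x $ j * cnj (y $ i))"
    by (rule sum.swap)
  also have "\<dots> = hermitian x (conj_transpose A *v y)"
    by (simp add: hermitian_def conj_transpose_def matrix_vector_mult_def sum_distrib_left algebra_simps)
  finally show ?thesis .
qed

lemma map_matrix_scale_vector_mult: "map_matrix (\<lambda>z. c * z) A *v x = c *s (A *v x)"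
  by (simp add: vec_eq_iff matrix_vector_mult_def sum_distrib_left algebra_simps)

section \<open>Derivatives of smooth maps\<close>

lemma smooth_on_has_vector_derivative:
  fixes f :: "real \<Rightarrow> 'b::real_normed_vector"
  assumes "smooth_on S f" "s \<in> S"
  shows "(f has_vector_derivative vector_derivative f (at s within S)) (at s within S)"
proof -
  have "Ck_on 1 S f" using assms by (simp add: smooth_on_def)
  then show ?thesis
    using assms(2) by (auto simp: vector_derivative_works[symmetric] differentiable_def)
qed

lemma has_derivative_compose_fst:
  assumes "(g has_vector_derivative g') (at s within I)"
  shows "((\<lambda>z. g (fst z)) has_derivative (\<lambda>\<xi>. fst \<xi> *\<^sub>R g')) (at (s, u) within I \<times> D)"
proof (rule has_derivative_in_compose[where f = fst and f' = fst and g = g and g' = "\<lambda>r. r *\<^sub>R g'"])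
  show "(fst has_derivative fst) (at (s, u) within I \<times> D)"
    by (auto intro!: derivative_eq_intros)
  show "(g has_derivative (\<lambda>r. r *\<^sub>R g')) (at (fst (s, u)) within fst ` (I \<times> D))"
    using assms by (auto simp: has_vector_derivative_def intro: has_derivative_subset)
qed

lemma smooth_on_second_derivative:
  assumes "smooth_on S f"
  obtains f' f'' where "\<And>x. x \<in> S \<Longrightarrow> (f has_derivative f' x) (at x within S)"
    and "\<And>x v. x \<in> S \<Longrightarrow> ((\<lambda>x. f' x v) has_derivative f'' v x) (at x within S)"
    and "\<And>v w. continuous_on S (\<lambda>x. f'' v x w)"
proof -
  have "Ck_on (Suc (Suc 0)) S f" using assms by (simp only: smooth_on_def)
  then obtain f' where 1: "\<forall>x\<in>S. (f has_derivative f' x) (at x within S)"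
    and "\<forall>v. \<exists>f''. (\<forall>x\<in>S. ((\<lambda>x. f' x v) has_derivative f'' x) (at x within S)) \<and>
      (\<forall>w. continuous_on S (\<lambda>x. f'' x w))"
    by auto
  \<comment> \<open>\<open>Ck_on\<close> supplies a second derivative for each direction
    \<open>v\<close> separately; choice collects them into one function of \<open>v\<close>.\<close>
  from choice[OF this(2)] obtain f'' where
    "\<forall>v. (\<forall>x\<in>S. ((\<lambda>x. f' x v) has_derivative f'' v x) (at x within S)) \<and>
      (\<forall>w. continuous_on S (\<lambda>x. f'' v x w))"
    by blast
  with 1 that show ?thesis by blast
qed

section \<open>Initial data\<close>

text \<open>A derivative within \<open>D\<close> is determined only in directions of
  \<open>L\<close>. For such a \<open>w\<close>, a short open segment through \<open>u\<close> stays
  in \<open>D\<close>, and on it \<open>g\<close> is constantly zero.\<close>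

lemma has_derivative_zero_along_subspace:
  assumes L: "subspace L" and D: "openin (top_of_set L) D"
    and g: "(g has_derivative g') (at u within D)" and u: "u \<in> D" and w: "w \<in> L"
    and zero: "\<And>x. x \<in> D \<Longrightarrow> g x = 0"
  shows "g' w = 0"
proof -
  obtain e where e: "e > 0" "ball u e \<inter> L \<subseteq> D"
    using D u by (auto simp: openin_contains_ball)
  define h where "h = e / (norm w + 1)"
  have "norm w + 1 > 0"
    by (simp add: add_nonneg_pos)
  then have h: "h > 0" and hd: "h * (norm w + 1) = e"
    using e by (auto simp: h_def)
  have "u \<in> L" using D u openin_imp_subset by blast
  have inD: "u + s *\<^sub>R w \<in> D" if "s \<in> {-h<..<h}" for s
  proof -
    have "\<bar>s\<bar> * norm w \<le> h * norm w"
      using that by (intro mult_right_mono) auto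
    also have "\<dots> < e" using h hd by (simp add: algebra_simps)
    finally have "u + s *\<^sub>R w \<in> ball u e" by (simp add: dist_norm)
    moreover have "u + s *\<^sub>R w \<in> L"
      using L w \<open>u \<in> L\<close> by (simp add: subspace_add subspace_scale)
    ultimately show ?thesis using e by blast
  qed
  have "((\<lambda>s. u + s *\<^sub>R w) has_derivative (\<lambda>r. r *\<^sub>R w)) (at 0 within {-h<..<h})"
    by (auto intro!: derivative_eq_intros)
  moreover have "(g has_derivative g') (at (u + 0 *\<^sub>R w) within (\<lambda>s. u + s *\<^sub>R w) ` {-h<..<h})"
  proof -
    have "(\<lambda>s. u + s *\<^sub>R w) ` {-h<..<h} \<subseteq> D" using inD by blast
    from has_derivative_subset[OF g this] show ?thesis by simp
  qed
  ultimately have "((\<lambda>s. g (u + s *\<^sub>R w)) has_derivative (\<lambda>r. g' (r *\<^sub>R w))) (at 0 within {-h<..<h})"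
    by (rule has_derivative_in_compose)
  then have "((\<lambda>s. 0) has_derivative (\<lambda>r. g' (r *\<^sub>R w))) (at 0 within {-h<..<h})"
  proof (rule has_derivative_transform[rotated 2])
    show "(0::real) \<in> {-h<..<h}" using h by simp
    show "0 = g (u + s *\<^sub>R w)" if "s \<in> {-h<..<h}" for s
      using zero[OF inD[OF that]] by simp
  qed
  \<comment> \<open>On an open interval around 0 the restricted derivative is the ordinary one,
    hence unique.\<close>
  then have "((\<lambda>s::real. 0) has_derivative (\<lambda>r. g' (r *\<^sub>R w))) (at 0)"
    using h at_within_open[of 0 "{-h<..<h}"] by simp
  then have "(\<lambda>r. g' (r *\<^sub>R w)) = (\<lambda>r. 0)"
    by (rule has_derivative_unique) simp
  from fun_cong[OF this, of 1] show ?thesis by simp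
qed

lemma tangent_spaceI:
  assumes "local_param M X L D \<phi>" "u \<in> D" "((X \<circ> \<phi>) has_derivative G) (at u within D)" "v \<in> L"
  shows "G v \<in> tangent_space M X (\<phi> u)"
  unfolding tangent_space_def
  by (rule CollectI, rule exI[of _ L], rule exI[of _ D], rule exI[of _ \<phi>], rule exI[of _ u],
      rule exI[of _ G], rule exI[of _ v]) (simp add: assms)

lemma local_param_in_topspace:
  assumes "local_param M X L D \<phi>" "u \<in> D"
  shows "\<phi> u \<in> topspace M"
proof -
  have "\<phi> ` D \<subseteq> topspace M"
    using assms(1) by (simp add: local_param_def openin_subset)
  with assms(2) show ?thesis by blast
qed

lemma initial_data_derivative_symmetric:
  assumes init: "initial_data k M X B b" and par: "local_param M X L D \<phi>"
  obtains f' where "\<And>x. x \<in> D \<Longrightarrow> ((X \<circ> \<phi>) has_derivative f' x) (at x within D)"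
    and "\<And>x v w. x \<in> D \<Longrightarrow> v \<in> L \<Longrightarrow> w \<in> L \<Longrightarrow>
      hermitian (f' x v) (B *v f' x w) = hermitian (f' x w) (B *v f' x v)"
proof -
  have L: "subspace L" and D: "openin (top_of_set L) D" and "smooth_on D (X \<circ> \<phi>)"
    using par by (auto simp: local_param_def)
  obtain f' f'' where f': "\<And>x. x \<in> D \<Longrightarrow> ((X \<circ> \<phi>) has_derivative f' x) (at x within D)"
    and f'': "\<And>x v. x \<in> D \<Longrightarrow> ((\<lambda>x. f' x v) has_derivative f'' v x) (at x within D)"
    and cont: "\<And>v w. continuous_on D (\<lambda>x. f'' v x w)"
    using smooth_on_second_derivative[OF \<open>smooth_on D (X \<circ> \<phi>)\<close>] by blast
  \<comment> \<open>Product rule in direction \<open>w\<close> for the function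
    \<open>hermitian (f' x v) (B *v X (\<phi> x) + b)\<close> of \<open>x\<close>, which vanishes on
    \<open>D\<close> because \<open>f' x v\<close> is tangent.\<close>
  have diff: "hermitian (f' x v) (B *v f' x w) + hermitian (f'' v x w) (B *v (X \<circ> \<phi>) x + b) = 0"
    if x: "x \<in> D" and v: "v \<in> L" and w: "w \<in> L" for x v w
  proof -
    have "((\<lambda>x. B *v (X \<circ> \<phi>) x + b) has_derivative (\<lambda>y. B *v f' x y)) (at x within D)"
      using has_derivative_add[OF has_derivative_matrix_vector_mult[OF has_derivative_const f'[OF x]]
          has_derivative_const, of B b] by simp
    note has_derivative_hermitian[OF f''[OF x, of v] this]
    from has_derivative_zero_along_subspace[OF L D this x w]
    show ?thesis
      using init tangent_spaceI[OF par _ f' v] local_param_in_topspace[OF par]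
      by (simp add: initial_data_def)
  qed
  have "hermitian (f' x v) (B *v f' x w) = hermitian (f' x w) (B *v f' x v)"
    if x: "x \<in> D" and v: "v \<in> L" and w: "w \<in> L" for x v w
  proof -
    have "f'' v x w = f'' w x v"
      by (rule second_derivative_symmetric[OF L D x v w f' f'' f'' cont cont])
    with diff[OF x v w] have "hermitian (f' x v) (B *v f' x w) + hermitian (f'' w x v) (B *v (X \<circ> \<phi>) x + b) = 0"
      by simp
    \<comment> \<open>Both products equal the negative of the same second-order term.\<close>
    with diff[OF x w v] show ?thesis
      unfolding add_eq_0_iff2 by simp
  qed
  with f' that show ?thesis by blast
qed

section \<open>Transport of the Kaehler form along the curve \<open>A\<close>\<close>

lemma kaehler_form_transport_zero:
  fixes A :: "real \<Rightarrow> complex^'n^'n"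
  assumes I: "is_interval I" "0 \<in> I" and s: "s \<in> I"
    and A: "\<And>t. t \<in> I \<Longrightarrow> (A has_vector_derivative A' t) (at t within I)"
    and A': "\<And>t. t \<in> I \<Longrightarrow> conj_transpose (A t) ** A' t = map_matrix (\<lambda>z. \<alpha> t * z) B"
    and A0: "A 0 = mat 1"
    and sym: "hermitian V (B *v W) = hermitian W (B *v V)"
    and zero: "kaehler_form V W = 0"
  shows "kaehler_form (A s *v V) (A s *v W) = 0"
proof -
  have adj: "hermitian (A t *v x) (A' t *v y) = cnj (\<alpha> t) * hermitian x (B *v y)" if "t \<in> I" for t x y
    by (simp add: hermitian_matrix_vector_mult_left matrix_vector_mul_assoc A'[OF that]
        map_matrix_scale_vector_mult hermitian_scale_right)
  have AV: "((\<lambda>t. A t *v V) has_derivative (\<lambda>r. r *\<^sub>R (A' t *v V))) (at t within I)" if "t \<in> I" for t V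
    using has_derivative_matrix_vector_mult[OF
        A[OF that, unfolded has_vector_derivative_def] has_derivative_const, of V]
    by (simp add: bounded_bilinear.scaleR_left[OF bounded_bilinear_matrix_vector_mult])
  have "((\<lambda>t. Im (hermitian (A t *v V) (A t *v W))) has_derivative (\<lambda>r. 0)) (at t within I)"
    if t: "t \<in> I" for t
  proof -
    \<comment> \<open>By \<open>adj\<close> and \<open>sym\<close> the two terms of the product rule
      are conjugate to each other, so their sum is real.\<close>
    have "hermitian (A' t *v V) (A t *v W) = cnj (hermitian (A t *v V) (A' t *v W))"
      by (subst hermitian_commute) (simp add: adj[OF t] sym)
    then have "Im (hermitian (A t *v V) (r *\<^sub>R (A' t *v W)) +
        hermitian (r *\<^sub>R (A' t *v V)) (A t *v W)) = 0" for r
      by (simp add: hermitian_scaleR_left hermitian_scaleR_right)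
    with has_derivative_Im[OF has_derivative_hermitian[OF AV[OF t] AV[OF t], of V W]]
    show ?thesis by simp
  qed
  \<comment> \<open>A vanishing derivative on the convex set \<open>I\<close> makes the imaginary
    part constant, and at 0 the matrix is the identity.\<close>
  from has_derivative_zero_constant[OF is_interval_convex[OF I(1)] this]
  obtain c where "\<forall>t\<in>I. Im (hermitian (A t *v V) (A t *v W)) = c" ..
  then have "Im (hermitian (A s *v V) (A s *v W)) = Im (hermitian (A 0 *v V) (A 0 *v W))"
    using I(2) s by simp
  then show ?thesis
    using zero by (simp add: kaehler_form_def A0)
qed

theorem theorem3:
  fixes k :: nat
    and M :: "'a topology" and X :: "'a \<Rightarrow> complex^'n"
    and B :: "complex^'n^'n" and b :: "complex^'n"
    and I :: "real set" and \<alpha> :: "real \<Rightarrow> complex"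
    and A :: "real \<Rightarrow> complex^'n^'n" and a :: "real \<Rightarrow> complex^'n"
  assumes "isotropic_submanifold k M X"
    and "invertible B"
    and "initial_data k M X B b"
    and "is_interval I" and "0 \<in> I"
    and "smooth_on I \<alpha>"
    and "\<forall>s\<in>I. invertible (A s)"
    and "smooth_on I A" and "smooth_on I a"
    and "\<forall>s\<in>I. conj_transpose (A s) ** vector_derivative A (at s within I)
           = map_matrix (\<lambda>z. \<alpha> s * z) B"
    and "\<forall>s\<in>I. conj_transpose (A s) *v vector_derivative a (at s within I) = \<alpha> s *s b"
    and "A 0 = mat 1" and "a 0 = 0"
  shows "isotropic_map I M X (\<lambda>(s, p). A s *v X p + a s)"
  unfolding isotropic_map_def
proof (intro allI impI ballI)
  fix L D \<phi> s u
  assume par: "local_param M X L D \<phi>" and s: "s \<in> I" and u: "u \<in> D"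
  define A' where "A' = (\<lambda>s. vector_derivative A (at s within I))"
  define a' where "a' = (\<lambda>s. vector_derivative a (at s within I))"
  have A: "(A has_vector_derivative A' t) (at t within I)" if "t \<in> I" for t
    using smooth_on_has_vector_derivative[OF assms(8) that] by (simp add: A'_def)
  have a: "(a has_vector_derivative a' t) (at t within I)" if "t \<in> I" for t
    using smooth_on_has_vector_derivative[OF assms(9) that] by (simp add: a'_def)
  have A'B: "conj_transpose (A t) ** A' t = map_matrix (\<lambda>z. \<alpha> t * z) B" if "t \<in> I" for t
    using assms(10) that by (simp add: A'_def)
  have a'b: "conj_transpose (A t) *v a' t = \<alpha> t *s b" if "t \<in> I" for t
    using assms(11) that by (simp add: a'_def)
  obtain f' where f': "\<And>x. x \<in> D \<Longrightarrow> ((X \<circ> \<phi>) has_derivative f' x) (at x within D)"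
    and sym: "\<And>x v w. x \<in> D \<Longrightarrow> v \<in> L \<Longrightarrow> w \<in> L \<Longrightarrow>
      hermitian (f' x v) (B *v f' x w) = hermitian (f' x w) (B *v f' x v)"
    using initial_data_derivative_symmetric[OF assms(3) par] by blast
  \<comment> \<open>\<open>N\<close> is the derivative of \<open>F\<close> in the direction of
    \<open>s\<close>, and \<open>G\<close> the full derivative of \<open>F\<close> at
    \<open>(s, u)\<close> in the local parametrization.\<close>
  define N where "N = A' s *v X (\<phi> u) + a' s"
  define G where "G = (\<lambda>\<xi>. A s *v f' u (snd \<xi>) + fst \<xi> *\<^sub>R N)"
  have tangent: "f' u v \<in> tangent_space M X (\<phi> u)" if "v \<in> L" for v
    using tangent_spaceI[OF par u f'[OF u] that] .
  have AA: "kaehler_form (A s *v f' u v) (A s *v f' u w) = 0" if "v \<in> L" "w \<in> L" for v w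
  proof (rule kaehler_form_transport_zero[OF assms(4,5) s A A'B assms(12) sym[OF u that]])
    show "kaehler_form (f' u v) (f' u w) = 0"
      using assms(1) tangent that local_param_in_topspace[OF par u]
      by (auto simp: isotropic_submanifold_def)
  qed
  have AN: "hermitian (A s *v f' u v) N = 0" if "v \<in> L" for v
  proof -
    have "conj_transpose (A s) *v N = \<alpha> s *s (B *v X (\<phi> u) + b)"
      by (simp add: N_def matrix_vector_right_distrib matrix_vector_mul_assoc A'B[OF s] a'b[OF s]
          map_matrix_scale_vector_mult vector_add_ldistrib)
    moreover have "hermitian (f' u v) (B *v X (\<phi> u) + b) = 0"
      using assms(3) tangent[OF that] local_param_in_topspace[OF par u]
      by (auto simp: initial_data_def)
    \<comment> \<open>The scalar multiple stays undistributed, so that the initial data condition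
      applies to \<open>B *v X (\<phi> u) + b\<close> as a whole.\<close>
    ultimately show ?thesis
      by (simp add: hermitian_matrix_vector_mult_left hermitian_scale_right del: vector_add_ldistrib)
  qed
  have NA: "hermitian N (A s *v f' u v) = 0" if "v \<in> L" for v
    using AN[OF that] hermitian_commute[of N] by simp
  \<comment> \<open>Both arguments of the form may have a component along \<open>N\<close>; the
    product of \<open>N\<close> with itself equals its own conjugate.\<close>
  have NN: "Im (hermitian N N) = 0"
    using hermitian_commute[of N N] by (metis cnj.simps(2) neg_equal_zero)
  have "kaehler_form (G \<xi>) (G \<eta>) = 0" if "\<xi> \<in> UNIV \<times> L" "\<eta> \<in> UNIV \<times> L" for \<xi> \<eta>
  proof -
    have "snd \<xi> \<in> L" "snd \<eta> \<in> L" using that by auto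
    \<comment> \<open>Real bilinear expansion into four terms: \<open>AA\<close> and
      \<open>NN\<close> remove the imaginary parts of the pure terms, \<open>AN\<close> and
      \<open>NA\<close> the mixed terms.\<close>
    with AA[of "snd \<xi>" "snd \<eta>"] AN NA NN show ?thesis
      by (simp add: G_def kaehler_form_def hermitian_add_left hermitian_add_right
          hermitian_scaleR_left hermitian_scaleR_right)
  qed
  moreover have "((\<lambda>(t, w). (\<lambda>(s, p). A s *v X p + a s) (t, \<phi> w)) has_derivative G)
      (at (s, u) within I \<times> D)"
  proof -
    have "((\<lambda>z. (X \<circ> \<phi>) (snd z)) has_derivative (\<lambda>\<xi>. f' u (snd \<xi>))) (at (s, u) within I \<times> D)"
    proof (rule has_derivative_in_compose[where f = snd and f' = snd and g = "X \<circ> \<phi>" and g' = "f' u"])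
      show "(snd has_derivative snd) (at (s, u) within I \<times> D)"
        by (auto intro!: derivative_eq_intros)
      show "((X \<circ> \<phi>) has_derivative f' u) (at (snd (s, u)) within snd ` (I \<times> D))"
        using f'[OF u] by (auto intro: has_derivative_subset)
    qed
    \<comment> \<open>Product rule for \<open>A *v X\<close>, with \<open>A\<close> depending on the
      first coordinate and \<open>X\<close> on the second, plus the derivative of
      \<open>a\<close>.\<close>
    from has_derivative_add[OF has_derivative_matrix_vector_mult[OF has_derivative_compose_fst[OF A[OF s]] this] has_derivative_compose_fst[OF a[OF s]]]
    show ?thesis
      by (simp add: G_def N_def case_prod_beta' bounded_bilinear.scaleR_left[OF bounded_bilinear_matrix_vector_mult] scaleR_add_right algebra_simps)
  qed
  ultimately show "\<exists>G. ((\<lambda>(t, w). (\<lambda>(s, p). A s *v X p + a s) (t, \<phi> w)) has_derivative G)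
      (at (s, u) within I \<times> D) \<and>
      (\<forall>\<xi>\<in>UNIV \<times> L. \<forall>\<eta>\<in>UNIV \<times> L. kaehler_form (G \<xi>) (G \<eta>) = 0)"
    by blast
qed

end
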